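(* Let $\mathcal{X}\subseteq\mathbb{R}^n$ be convex and closed, and let $f$ be a real-valued function that is continuously differentiable (on an open set containing $\mathcal{X}$). Let $x^*\in\mathcal{X}$ satisfy $$\langle\nabla f(x),x-x^*\rangle\ge0\quad\text{for all }x\in\mathcal{X}.$$ Then $f(x^* )\le f(x)$ for all $x\in\mathcal{X}$; that is, a Minty solution $x^*$, if it exists, is a global solution of $\min_{x\in\mathcal{X}}f(x)$.
   Context: A Minty solution of the problem $\min_{x\in\mathcal{X}} f(x)$ is a point $x^*\in\mathcal{X}$ with $\langle\nabla f(x),x-x^*\rangle\ge0$ for all $x\in\mathcal{X}$. *)

theory Defs
  imports "HOL-Analysis.Analysis"
begin

(* Meaningful only at points where f is differentiable; there the gradient is unique. *)
definition gradient :: "('a::real_inner \<Rightarrow> real) \<Rightarrow> 'a \<Rightarrow> 'a"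
  where "gradient f x = (THE D. GDERIV f x :> D)"

lemma gradient_eqI:
  assumes "GDERIV f x :> D"
  shows "gradient f x = D"
  unfolding gradient_def
proof (rule the_equality)
  fix D' assume "GDERIV f x :> D'"
  then have "(\<lambda>h. h \<bullet> D') = (\<lambda>h. h \<bullet> D)"
    using assms unfolding gderiv_def by (intro has_derivative_unique[of f _ x])
  then show "D' = D"
    unfolding fun_eq_iff by (rule vector_eq_ldot[THEN iffD1])
qed (fact assms)

lemma differentiable_imp_gderiv:
  fixes f :: "'a::euclidean_space \<Rightarrow> real"
  assumes "f differentiable (at x)"
  shows "GDERIV f x :> gradient f x"
proof -
  obtain f' where f': "(f has_derivative f') (at x)"
    using assms unfolding differentiable_def by blast
  interpret bounded_linear f' using f' by (rule has_derivative_bounded_linear)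
  have "f' = (\<lambda>h. h \<bullet> adjoint f' 1)"
  proof
    fix h show "f' h = h \<bullet> adjoint f' 1"
      using adjoint_works[OF linear_axioms, of h 1] by simp
  qed
  then have D: "GDERIV f x :> adjoint f' 1"
    using f' unfolding gderiv_def by simp
  show ?thesis
    unfolding gradient_eqI[OF D] by (fact D)
qed

definition continuously_differentiable_on ::
    "('a::real_inner \<Rightarrow> real) \<Rightarrow> 'a set \<Rightarrow> bool"  (infix "continuously'_differentiable'_on" 50)
  where "f continuously_differentiable_on U \<longleftrightarrow>
    (\<forall>x\<in>U. f differentiable (at x)) \<and> continuous_on U (gradient f)"

definition minty_solution :: "('a::real_inner \<Rightarrow> real) \<Rightarrow> 'a set \<Rightarrow> 'a \<Rightarrow> bool"
  where "minty_solution f X xstar \<longleftrightarrow>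
    xstar \<in> X \<and> (\<forall>x\<in>X. gradient f x \<bullet> (x - xstar) \<ge> 0)"

end

theory Submission
  imports Defs
begin

text \<open>
  Restrict \<open>f\<close> to the segment from \<open>xstar\<close> to \<open>x\<close>. By the mean value theorem, \<open>f x - f xstar\<close>
  is the directional derivative of \<open>f\<close> along \<open>x - xstar\<close> at an interior point
  \<open>z = xstar + t (x - xstar)\<close>, \<open>0 < t < 1\<close>. By convexity \<open>z\<close> is feasible, and
  \<open>z - xstar\<close> is the positive multiple \<open>t (x - xstar)\<close>, so the Minty inequality at \<open>z\<close>
  says precisely that this directional derivative is nonnegative.
\<close>

text \<open>
  The mean value point must be strictly inside the segment: at the end \<open>a\<close> the vector \<open>z - a\<close>
  vanishes, and an inequality for its inner product with the gradient would carry no information.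
\<close>
lemma mean_value_segment_gradient:
  fixes f :: "'a::euclidean_space \<Rightarrow> real"
  assumes diff: "\<And>z. z \<in> closed_segment a b \<Longrightarrow> f differentiable (at z)"
  obtains t where "0 < t" "t < 1"
    "f b - f a = gradient f (a + t *\<^sub>R (b - a)) \<bullet> (b - a)"
proof -
  define p where "p t = a + t *\<^sub>R (b - a)" for t :: real
  have p_segment: "p t \<in> closed_segment a b" if "0 \<le> t" "t \<le> 1" for t
    using that by (auto simp: p_def in_segment algebra_simps)
  have deriv: "((f \<circ> p) has_derivative (\<lambda>h. (h *\<^sub>R (b - a)) \<bullet> gradient f (p t))) (at t)"
    if "0 \<le> t" "t \<le> 1" for t
  proof -
    have "(p has_derivative (\<lambda>h. h *\<^sub>R (b - a))) (at t)"
      unfolding p_def by (auto intro!: derivative_eq_intros)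
    moreover have "(f has_derivative (\<lambda>h. h \<bullet> gradient f (p t))) (at (p t))"
      using differentiable_imp_gderiv[OF diff[OF p_segment[OF that]]] unfolding gderiv_def .
    ultimately show ?thesis
      using diff_chain_at by (fastforce simp: o_def)
  qed
  have "continuous_on {0..1} (f \<circ> p)"
    by (rule has_derivative_continuous_on[OF has_derivative_at_withinI[OF deriv]]) auto
  then obtain t where t: "0 < t" "t < 1"
    and "(f \<circ> p) 1 - (f \<circ> p) 0 = ((1 - 0) *\<^sub>R (b - a)) \<bullet> gradient f (p t)"
    using mvt[of 0 1 "f \<circ> p" "\<lambda>t h. (h *\<^sub>R (b - a)) \<bullet> gradient f (p t)"] deriv by auto
  then have "f b - f a = gradient f (a + t *\<^sub>R (b - a)) \<bullet> (b - a)"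
    by (simp add: p_def inner_commute)
  with t show thesis by (rule that)
qed

theorem theorem2p10:
  fixes f :: "real ^ 'n \<Rightarrow> real"
    and X U :: "(real ^ 'n) set"
    and xstar :: "real ^ 'n"
  assumes "convex X" and "closed X"
    and "open U" and "X \<subseteq> U" and "f continuously_differentiable_on U"
    and "minty_solution f X xstar"
  shows "\<forall>x\<in>X. f xstar \<le> f x"
proof
  fix x assume x: "x \<in> X"
  have xstar: "xstar \<in> X"
    and minty: "\<And>z. z \<in> X \<Longrightarrow> 0 \<le> gradient f z \<bullet> (z - xstar)"
    using \<open>minty_solution f X xstar\<close> by (auto simp: minty_solution_def)
  have segment: "closed_segment xstar x \<subseteq> X"
    by (rule closed_segment_subset[OF xstar x \<open>convex X\<close>])
  have diff: "f differentiable (at z)" if "z \<in> closed_segment xstar x" for z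
    using that segment \<open>X \<subseteq> U\<close> \<open>f continuously_differentiable_on U\<close>
    by (auto simp: continuously_differentiable_on_def)
  obtain t where t: "0 < t" "t < 1"
    and mean: "f x - f xstar = gradient f (xstar + t *\<^sub>R (x - xstar)) \<bullet> (x - xstar)"
    using mean_value_segment_gradient[OF diff] by blast
  have "xstar + t *\<^sub>R (x - xstar) \<in> closed_segment xstar x"
    using t by (auto simp: in_segment algebra_simps intro!: exI[of _ t])
  then have "0 \<le> t * (gradient f (xstar + t *\<^sub>R (x - xstar)) \<bullet> (x - xstar))"
    using minty segment by fastforce
  then have "0 \<le> f x - f xstar"
    using t mean by (simp add: zero_le_mult_iff)
  then show "f xstar \<le> f x" by simp
qed

end
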